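(* There exists a positive integer $K_0$ such that for every integer $K\ge K_0$, $$\#\{n\le K:\ \sigma(30n+1)<\sigma(30n)\}\;>\;\#\{n\le K:\ \sigma(30n+1)>\sigma(30n)\},$$ where $n$ ranges over positive integers.
   Context: For a positive integer $n$, $\sigma(n)$ denotes the sum of all positive divisors of $n$. *)

theory Defs
  imports Complex_Main
begin

(* Meant for n > 0; every d divides 0, so sigma 0 is a sum over an infinite set, hence 0. *)
definition sigma :: "nat \<Rightarrow> nat" where
  "sigma n = (\<Sum>d | d dvd n. d)"

end

theory Submission
  imports Defs
begin

text \<open>Always $\sigma(30n) \ge \sigma(30)\,n = 72n$, so $\sigma(m) \ge \sigma(30n)$ with $m = 30n+1$ forces
$\sigma(m)/m - 1 = \sum_{d \mid m,\, d > 1} 1/d \ge 1$. As $m$ is coprime to $30$, only $d \ge 7$ occur, and each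
such $d$ divides at most $K/d + 1$ of the numbers $30n+1$ with $n \le K$. Hence the average of
$\sigma(m)/m - 1$ is at most $\sum_{d \ge 7} 1/d^2 + o(1) < 1/6 + o(1)$, and by Markov's inequality fewer than
half of the $n \le K$ satisfy $\sigma(30n+1) \ge \sigma(30n)$.\<close>

text \<open>The map \<open>d \<mapsto> d * n\<close> sends divisors of \<open>k\<close> injectively
  to divisors of \<open>k * n\<close>.\<close>

lemma sigma_mult_ge:
  assumes "k > 0" "n > 0"
  shows "sigma k * n \<le> sigma (k * n)"
proof -
  have "sigma k * n = (\<Sum>d\<in>(\<lambda>d. d * n) ` {d. d dvd k}. d)"
    using assms by (subst sum.reindex) (auto simp: inj_on_def sigma_def sum_distrib_right)
  also have "\<dots> \<le> (\<Sum>d | d dvd k * n. d)"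
    using assms by (intro sum_mono2) auto
  finally show ?thesis by (simp add: sigma_def)
qed

lemma sigma_30: "sigma 30 = 72"
proof -
  \<comment> \<open>Filtering a finite interval makes the divisor set computable by
    evaluation.\<close>
  have "{d::nat. d dvd 30} = Set.filter (\<lambda>d. d dvd 30) {1..30}"
    by (auto dest: dvd_imp_le intro!: Suc_leI Nat.gr0I)
  also have "\<dots> = {1, 2, 3, 5, 6, 10, 15, 30}"
    by code_simp
  finally show ?thesis by (simp add: sigma_def)
qed

text \<open>The involution \<open>d \<mapsto> m div d\<close> permutes the divisors of
  \<open>m\<close>.\<close>

lemma sigma_eq_sum_inverse:
  assumes "m > 0"
  shows "real (sigma m) = real m * (\<Sum>d | d dvd m. 1 / real d)"
proof -
  have "real (sigma m) = (\<Sum>d | d dvd m. real d)"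
    by (simp add: sigma_def)
  also have "\<dots> = (\<Sum>d | d dvd m. real m / real d)"
    using assms
    by (intro sum.reindex_bij_witness[of _ "\<lambda>d. m div d" "\<lambda>d. m div d"])
      (auto simp: real_of_nat_div div_div_eq_right)
  finally show ?thesis by (simp add: sum_distrib_left)
qed

lemma dvd_30_mult_plus_1:
  fixes d n :: nat
  assumes "d dvd 30 * n + 1"
  shows "coprime d 30" "d = 1 \<or> 7 \<le> d"
proof -
  have "coprime (30 * n + 1) (30 * n)"
    using coprime_Suc_left_nat[of "30 * n"] by (simp only: Suc_eq_plus1)
  hence "coprime d (30 * n)"
    by (rule coprime_divisors[OF assms dvd_refl])
  thus cop: "coprime d 30" by simp
  have no: "\<not> p dvd d" if "p dvd 30" "p \<noteq> 1" for p
    using cop that by (meson coprime_common_divisor_nat)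
  have "\<not> 2 dvd d" by (rule no) simp_all
  moreover have "\<not> 3 dvd d" by (rule no) simp_all
  moreover have "\<not> 5 dvd d" by (rule no) simp_all
  \<comment> \<open>Of 0, ..., 6 only 1 avoids the factors 2, 3 and 5; 0 is excluded as a multiple
    of 2.\<close>
  ultimately show "d = 1 \<or> 7 \<le> d" by presburger
qed

text \<open>As \<open>a\<close> is invertible modulo \<open>d\<close>, all solutions
  \<open>n\<close> lie in one residue class. So each quotient \<open>n div d\<close> in
  \<open>{0..K div d}\<close> occurs at most once; the quotient 0 accounts for the
  \<open>+ 1\<close>.\<close>

lemma card_dvd_linear_le:
  fixes a d K :: nat
  assumes "coprime d a"
  shows "card {n\<in>{1..K}. d dvd a * n + 1} \<le> K div d + 1"
proof -
  let ?C = "{n\<in>{1..K}. d dvd a * n + 1}"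
  have le: "x = y" if "x \<in> ?C" "y \<in> ?C" "x div d = y div d" "x \<le> y" for x y
  proof -
    have "d dvd (a * y + 1) - (a * x + 1)"
      using that by (intro dvd_diff_nat) auto
    hence "d dvd a * (y - x)" by (simp add: diff_mult_distrib2)
    hence "d dvd y - x" using assms by (simp add: coprime_dvd_mult_right_iff)
    hence "x mod d = y mod d"
      using \<open>x \<le> y\<close> by (metis mod_eq_dvd_iff_nat)
    thus ?thesis using that(3) by (metis div_mult_mod_eq)
  qed
  have "inj_on (\<lambda>n. n div d) ?C"
  proof (rule inj_onI)
    fix x y
    assume xy: "x \<in> ?C" "y \<in> ?C" "x div d = y div d"
    show "x = y"
      using le[OF xy] le[OF xy(2,1) xy(3)[symmetric]] by linarith
  qed
  moreover have "(\<lambda>n. n div d) ` ?C \<subseteq> {..K div d}"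
    by (auto intro: div_le_mono)
  ultimately have "card ?C \<le> card {..K div d}"
    by (intro card_inj_on_le) auto
  thus ?thesis by simp
qed

text \<open>Telescoping: \<open>1 / (N + 1)^2\<close> is at most \<open>1 / N - 1 / (N + 1)\<close>.
  The induction starts at \<open>N = 6\<close>, where the sum is empty and the bound is 0.\<close>

lemma sum_inverse_squares_le:
  "(\<Sum>d=7..N. 1 / (real d)\<^sup>2) \<le> 1 / 6"
proof -
  have bound: "(\<Sum>d=7..N. 1 / (real d)\<^sup>2) \<le> 1 / 6 - 1 / real N" if "N \<ge> 6"
    using that
  proof (induction N rule: dec_induct)
    case (step N)
    have "1 / (real N + 1)\<^sup>2 \<le> 1 / real N - 1 / (real N + 1)"
      using step.hyps by (simp add: divide_simps power2_eq_square)
    thus ?case using step by (simp add: add.commute)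
  qed simp
  show ?thesis
  proof (cases "N \<ge> 6")
    case True
    have "1 / real N \<ge> 0" by simp
    with bound[OF True] show ?thesis by linarith
  qed simp
qed

text \<open>A crude harmonic bound: any o(N) estimate is enough for the error term, and the square
  root needs no logarithms. The increment of \<open>2 * sqrt\<close> from \<open>N\<close> to
  \<open>N + 1\<close> is at least \<open>1 / sqrt (N + 1)\<close>, hence at least
  \<open>1 / (N + 1)\<close>.\<close>

lemma sum_inverse_le_sqrt:
  "(\<Sum>d=1..N. 1 / real d) \<le> 2 * sqrt (real N)"
proof (induction N)
  case (Suc N)
  let ?a = "sqrt (real N)" and ?b = "sqrt (real (Suc N))"
  have b: "?b \<ge> 1" "?b \<ge> ?a" "?b\<^sup>2 = real (Suc N)" "?a\<^sup>2 = real N" by simp_all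
  have "1 = (?b - ?a) * (?b + ?a)"
    using b(3,4) by (simp add: algebra_simps power2_eq_square)
  also have "\<dots> \<le> (?b - ?a) * (2 * ?b)"
    using b by (intro mult_left_mono) auto
  finally have "1 / ?b \<le> 2 * (?b - ?a)"
    using b(1) by (simp add: field_simps)
  moreover have "1 / real (Suc N) \<le> 1 / ?b"
    using self_le_power[OF b(1), of 2] by (simp add: divide_left_mono)
  ultimately show ?case using Suc by simp
qed simp

text \<open>Swapping the sums counts, for each \<open>d\<close>, the \<open>n\<close> with
  \<open>d dvd 30 * n + 1\<close>. The part \<open>K / d\<close> of the count yields
  \<open>K\<close> times a sum of inverse squares; the \<open>+ 1\<close> yields a harmonic
  sum.\<close>

lemma sum_inverse_divisors_le:
  "(\<Sum>n=1..K. \<Sum>d\<in>{d\<in>{7..30 * K + 1}. d dvd 30 * n + 1}. 1 / real d)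
     \<le> real K / 6 + 2 * sqrt (real (30 * K + 1))"
proof -
  let ?N = "30 * K + 1"
  let ?c = "\<lambda>d. card {n\<in>{1..K}. d dvd 30 * n + 1}"
  have c: "real (?c d) \<le> real K / real d + 1" for d
  proof (cases "coprime d 30")
    case True
    hence "real (?c d) \<le> real (K div d + 1)"
      by (intro of_nat_mono card_dvd_linear_le)
    thus ?thesis using of_nat_div_le_of_nat[where 'a = real and n = K and x = d] by simp
  next
    case False
    hence "{n\<in>{1..K}. d dvd 30 * n + 1} = {}"
      using dvd_30_mult_plus_1(1) by blast
    hence "?c d = 0" by (simp only: card.empty)
    thus ?thesis by (simp only: of_nat_0) simp
  qed
  have "(\<Sum>n=1..K. \<Sum>d\<in>{d\<in>{7..?N}. d dvd 30 * n + 1}. 1 / real d)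
      = (\<Sum>d=7..?N. \<Sum>n\<in>{n\<in>{1..K}. d dvd 30 * n + 1}. 1 / real d)"
    by (rule sum.swap_restrict) auto
  also have "\<dots> = (\<Sum>d=7..?N. real (?c d) / real d)" by simp
  also have "\<dots> \<le> (\<Sum>d=7..?N. (real K / real d + 1) / real d)"
    by (intro sum_mono divide_right_mono c) auto
  also have "\<dots> = real K * (\<Sum>d=7..?N. 1 / (real d)\<^sup>2) + (\<Sum>d=7..?N. 1 / real d)"
    unfolding sum_distrib_left sum.distrib[symmetric]
    by (rule sum.cong) (simp_all add: add_divide_distrib power2_eq_square)
  also have "\<dots> \<le> real K * (1 / 6) + (\<Sum>d=1..?N. 1 / real d)"
    by (intro add_mono mult_left_mono sum_inverse_squares_le sum_mono2) auto
  also have "\<dots> \<le> real K / 6 + 2 * sqrt (real ?N)"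
    using sum_inverse_le_sqrt[of ?N] by simp
  finally show ?thesis .
qed

lemma sum_inverse_divisors_ge_1:
  assumes "1 \<le> n" "n \<le> K" "sigma (30 * n) \<le> sigma (30 * n + 1)"
  shows "1 \<le> (\<Sum>d\<in>{d\<in>{7..30 * K + 1}. d dvd 30 * n + 1}. 1 / real d)"
proof -
  let ?m = "30 * n + 1"
  let ?D = "{d\<in>{7..30 * K + 1}. d dvd ?m}"
  \<comment> \<open>Bounding divisors by \<open>30 * K + 1\<close> gives a range of \<open>d\<close>
    independent of \<open>n\<close>, as the swap of sums requires.\<close>
  have "d \<le> 30 * K + 1" if "d dvd ?m" for d
    using dvd_imp_le[OF that] assms(2) by linarith
  hence D: "{d. d dvd ?m} = insert 1 ?D"
    using dvd_30_mult_plus_1(2)[of _ n] by auto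
  have "2 * ?m \<le> 72 * n" using assms(1) by simp
  also have "\<dots> \<le> sigma ?m"
    using sigma_mult_ge[of 30 n] assms sigma_30 by simp
  finally have "real ?m * 2 \<le> real (sigma ?m)" by linarith
  also have "\<dots> = real ?m * (1 + (\<Sum>d\<in>?D. 1 / real d))"
    by (subst sigma_eq_sum_inverse, simp, subst D, subst sum.insert) auto
  finally have "2 \<le> 1 + (\<Sum>d\<in>?D. 1 / real d)"
    by (rule mult_left_le_imp_le) simp
  thus ?thesis by simp
qed

theorem theorem1:
  shows "\<exists>K0::nat. K0 > 0 \<and>
    (\<forall>K::nat. K \<ge> K0 \<longrightarrow>
      card {n::nat. 1 \<le> n \<and> n \<le> K \<and> sigma (30 * n + 1) < sigma (30 * n)} >
      card {n::nat. 1 \<le> n \<and> n \<le> K \<and> sigma (30 * n + 1) > sigma (30 * n)})"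
\<comment> \<open>The error term must satisfy \<open>2 * sqrt (30 * K + 1) < K / 3\<close>, that is
  \<open>36 * (30 * K + 1) < K^2\<close>. This holds from \<open>K = 1081\<close> on; 2000 is a
  round choice.\<close>
proof (intro exI[of _ 2000] conjI allI impI)
  fix K :: nat
  assume K: "K \<ge> 2000"
  let ?L = "{n::nat. 1 \<le> n \<and> n \<le> K \<and> sigma (30 * n + 1) < sigma (30 * n)}"
  let ?G = "{n::nat. 1 \<le> n \<and> n \<le> K \<and> sigma (30 * n + 1) > sigma (30 * n)}"
  \<comment> \<open>\<open>?B\<close> includes the ties, so it contains \<open>?G\<close> and
    together with \<open>?L\<close> covers \<open>{1..K}\<close>. Once \<open>?B\<close> has fewer
    than \<open>K / 2\<close> elements, \<open>?L\<close> has more than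
    \<open>K / 2\<close>.\<close>
  let ?B = "{n\<in>{1..K}. sigma (30 * n) \<le> sigma (30 * n + 1)}"
  let ?f = "\<lambda>n. \<Sum>d\<in>{d\<in>{7..30 * K + 1}. d dvd 30 * n + 1}. 1 / real d"
  have "real (card ?B) = (\<Sum>n\<in>?B. 1)" by simp
  also have "\<dots> \<le> (\<Sum>n\<in>?B. ?f n)"
    by (intro sum_mono sum_inverse_divisors_ge_1) auto
  also have "\<dots> \<le> (\<Sum>n=1..K. ?f n)"
    by (intro sum_mono2) (auto intro: sum_nonneg)
  also have "\<dots> \<le> real K / 6 + 2 * sqrt (real (30 * K + 1))"
    by (rule sum_inverse_divisors_le)
  also have "\<dots> < real K / 2"
  proof -
    have "36 * real (30 * K + 1) < 2000 * real K" using K by simp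
    also have "\<dots> \<le> real K * real K" using K by (intro mult_right_mono) auto
    finally have "real (30 * K + 1) < (real K / 6)\<^sup>2"
      by (simp add: power2_eq_square)
    hence "sqrt (real (30 * K + 1)) < real K / 6"
      by (intro real_less_lsqrt) auto
    thus ?thesis by simp
  qed
  finally have B: "2 * card ?B < K" by linarith
  have "card {1..K} = card (?L \<union> ?B)" by (rule arg_cong[where f = card]) auto
  also have "\<dots> \<le> card ?L + card ?B" by (rule card_Un_le)
  finally have "K \<le> card ?L + card ?B" by (simp only: card_atLeastAtMost)
  moreover have "card ?G \<le> card ?B" by (intro card_mono) auto
  ultimately show "card ?L > card ?G" using B by linarith
qed simp

end
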